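(* Let $Y$ be a Banach space and let $A:\ell^1(\mathbb{N})\to Y$ be an injective bounded linear operator. Let $c\in[0,1)$ and suppose that for each $n\in\mathbb{N}$ and all $k\in\{1,\ldots,n\}$ there are $f^{(n,k)}\in Y^\ast$ such that for every $n\in\mathbb{N}$: (a) for each $k\in\{1,\ldots,n\}$ we have $[A^\ast f^{(n,k)}]_l=0$ for all $l\in\{1,\ldots,n\}\setminus\{k\}$ and $[A^\ast f^{(n,k)}]_k=1$; (b) $\sum_{k=1}^n\bigl|[A^\ast f^{(n,k)}]_l\bigr|\leq c$ for all $l>n$. Then the Source Assumption (defined in the context) holds for $A$ with $\mathcal{M}_n=\{\{1,\ldots,n\}\}$ for all $n\in\mathbb{N}$, with the same constant $c$, and with $\gamma_n=\sum_{k=1}^n\|f^{(n,k)}\|_{Y^\ast}$.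
   Context: Sequences are real and indexed by $\mathbb{N}=\{1,2,\ldots\}$; $[\xi]_l$ denotes the $l$-th component of a sequence $\xi$. $A^\ast:Y^\ast\to\ell^\infty(\mathbb{N})$ is the adjoint of $A$, where $\ell^\infty(\mathbb{N})$ is identified with the dual of $\ell^1(\mathbb{N})$. For $M\subseteq\mathbb{N}$, $P_M$ denotes the projection (on $\ell^\infty(\mathbb{N})$ and on $\ell^1(\mathbb{N})$) given by $[P_M\xi]_k=\xi_k$ if $k\in M$ and $[P_M\xi]_k=0$ otherwise; $I$ is the identity. $\supp\xi=\{k\in\mathbb{N}:\xi_k\neq0\}$. Let $$\mathbf{1}_M:=\{\xi\in\ell^\infty(\mathbb{N}):\supp\xi\subseteq M\text{ and }\xi_k\in\{-1,0,1\}\text{ for all }k\in\mathbb{N}\}.$$ Source Assumption (for $A$, with $(\mathcal{M}_n)_{n\in\mathbb{N}}$, constants $\gamma_n>0$ and $c\in[0,1)$): for each $n\in\mathbb{N}$, $\mathcal{M}_n$ is a family of index sets $M\subseteq\mathbb{N}$ of cardinality $|M|=n$ with $\{1,\ldots,n\}\in\mathcal{M}_n$; and for each $n\in\mathbb{N}$ and each $\xi\in\bigcup_{M\in\mathcal{M}_n}\mathbf{1}_M$ there is some $\eta=\eta(n,\xi)\in Y^\ast$ such that (i) $\|\eta\|_{Y^\ast}\leq\gamma_n$ (with $\gamma_n$ independent of $\xi$); (ii) $P_{\supp\xi}A^\ast\eta=\xi$; (iii) $\|(I-P_{\supp\xi})A^\ast\eta\|_{\ell^\infty(\mathbb{N})}\leq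 c$ (with $c$ independent of $\xi$ and $n$). *)

theory Defs
  imports "HOL-Analysis.Analysis"
begin

text \<open>
  Sequences indexed by \<open>{1, 2, \<dots>}\<close> are represented as functions on \<^typ>\<open>nat\<close> that vanish
  at the dummy index \<open>0\<close>, so that all indices and index sets read as in the mathematics.
\<close>

typedef ell1 = "{x :: nat \<Rightarrow> real. x 0 = 0 \<and> summable (\<lambda>k. \<bar>x k\<bar>)}"
  morphisms ell1_nth Abs_ell1
  by (rule exI[of _ "\<lambda>_. 0"]) simp

typedef ellinf = "{x :: nat \<Rightarrow> real. x 0 = 0 \<and> bounded (range x)}"
  morphisms ellinf_nth Abs_ellinf
  by (rule exI[of _ "\<lambda>_. 0"]) simp

setup_lifting type_definition_ell1
setup_lifting type_definition_ellinf

lemma ell1_nth_0 [simp]: "ell1_nth x 0 = 0"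
  by transfer simp

lemma summable_ell1: "summable (\<lambda>k. \<bar>ell1_nth x k\<bar>)"
  by transfer simp

lemma ell1_eqI: "(\<And>k. k \<ge> 1 \<Longrightarrow> ell1_nth x k = ell1_nth y k) \<Longrightarrow> x = y"
  by transfer (metis ext less_one linorder_not_le)

lemma ellinf_nth_0 [simp]: "ellinf_nth x 0 = 0"
  by transfer simp

lemma bounded_ellinf: "bounded (range (ellinf_nth x))"
  by transfer simp

lemma ellinf_eqI: "(\<And>k. k \<ge> 1 \<Longrightarrow> ellinf_nth x k = ellinf_nth y k) \<Longrightarrow> x = y"
  by transfer (metis ext less_one linorder_not_le)

instantiation ell1 :: real_vector
begin

lift_definition zero_ell1 :: ell1 is "\<lambda>_. 0" by simp
lift_definition plus_ell1 :: "ell1 \<Rightarrow> ell1 \<Rightarrow> ell1" is "\<lambda>x y k. x k + y k"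
  subgoal for x y
    using summable_comparison_test'[OF summable_add[of "\<lambda>k. \<bar>x k\<bar>" "\<lambda>k. \<bar>y k\<bar>"],
        where N = 0 and f = "\<lambda>k. \<bar>x k + y k\<bar>"]
    by (simp add: abs_triangle_ineq)
  done
lift_definition uminus_ell1 :: "ell1 \<Rightarrow> ell1" is "\<lambda>x k. - x k" by simp
lift_definition minus_ell1 :: "ell1 \<Rightarrow> ell1 \<Rightarrow> ell1" is "\<lambda>x y k. x k - y k"
  subgoal for x y
    using summable_comparison_test'[OF summable_add[of "\<lambda>k. \<bar>x k\<bar>" "\<lambda>k. \<bar>y k\<bar>"],
        where N = 0 and f = "\<lambda>k. \<bar>x k - y k\<bar>"]
    by (simp add: abs_triangle_ineq4)
  done
lift_definition scaleR_ell1 :: "real \<Rightarrow> ell1 \<Rightarrow> ell1" is "\<lambda>r x k. r * x k"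
  by (auto simp: abs_mult summable_mult)

instance
  by standard (transfer; simp add: fun_eq_iff algebra_simps)+

end

instantiation ell1 :: real_normed_vector
begin

definition norm_ell1 :: "ell1 \<Rightarrow> real" where
  "norm_ell1 x = (\<Sum>k. \<bar>ell1_nth x k\<bar>)"
definition sgn_ell1 :: "ell1 \<Rightarrow> ell1" where
  "sgn_ell1 x = inverse (norm x) *\<^sub>R x"
definition dist_ell1 :: "ell1 \<Rightarrow> ell1 \<Rightarrow> real" where
  "dist_ell1 x y = norm (x - y)"
definition uniformity_ell1 :: "(ell1 \<times> ell1) filter" where
  "uniformity_ell1 = (INF e\<in>{0<..}. principal {(x, y). dist x y < e})"
definition open_ell1 :: "ell1 set \<Rightarrow> bool" where
  "open_ell1 U = (\<forall>x\<in>U. eventually (\<lambda>(x', y). x' = x \<longrightarrow> y \<in> U) uniformity)"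

instance
proof
  fix x y :: ell1 and a :: real
  show "(norm x = 0) = (x = 0)"
    unfolding norm_ell1_def by transfer (auto simp: suminf_eq_zero_iff fun_eq_iff)
  show "norm (x + y) \<le> norm x + norm y"
    using summable_ell1[of x] summable_ell1[of y] summable_ell1[of "x + y"]
    by (simp add: norm_ell1_def suminf_add plus_ell1.rep_eq abs_triangle_ineq suminf_le summable_add)
  show "norm (a *\<^sub>R x) = \<bar>a\<bar> * norm x"
    using summable_ell1[of x] by (simp add: norm_ell1_def scaleR_ell1.rep_eq abs_mult suminf_mult)
qed (simp_all add: sgn_ell1_def dist_ell1_def uniformity_ell1_def open_ell1_def)

end

instantiation ellinf :: real_vector
begin

lift_definition zero_ellinf :: ellinf is "\<lambda>_. 0" by simp
lift_definition plus_ellinf :: "ellinf \<Rightarrow> ellinf \<Rightarrow> ellinf" is "\<lambda>x y k. x k + y k"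
  by (auto intro: bounded_plus_comp)
lift_definition uminus_ellinf :: "ellinf \<Rightarrow> ellinf" is "\<lambda>x k. - x k"
  by (auto simp: bounded_iff)
lift_definition minus_ellinf :: "ellinf \<Rightarrow> ellinf \<Rightarrow> ellinf" is "\<lambda>x y k. x k - y k"
  by (auto intro: bounded_minus_comp)
lift_definition scaleR_ellinf :: "real \<Rightarrow> ellinf \<Rightarrow> ellinf" is "\<lambda>r x k. r * x k"
  using bounded_scaleR_comp[where 'a = nat and 'b = real] by auto

instance
  by standard (transfer; simp add: fun_eq_iff algebra_simps)+

end

lemma bdd_above_ellinf: "bdd_above ((\<lambda>k. \<bar>ellinf_nth x k\<bar>) ` S)"
proof -
  obtain B where "\<And>k. \<bar>ellinf_nth x k\<bar> \<le> B"
    using bounded_ellinf[of x] by (auto simp: bounded_iff)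
  then show ?thesis by (intro bdd_aboveI2[where M = B])
qed

instantiation ellinf :: real_normed_vector
begin

definition norm_ellinf :: "ellinf \<Rightarrow> real" where
  "norm_ellinf x = (SUP k\<in>{1..}. \<bar>ellinf_nth x k\<bar>)"
definition sgn_ellinf :: "ellinf \<Rightarrow> ellinf" where
  "sgn_ellinf x = inverse (norm x) *\<^sub>R x"
definition dist_ellinf :: "ellinf \<Rightarrow> ellinf \<Rightarrow> real" where
  "dist_ellinf x y = norm (x - y)"
definition uniformity_ellinf :: "(ellinf \<times> ellinf) filter" where
  "uniformity_ellinf = (INF e\<in>{0<..}. principal {(x, y). dist x y < e})"
definition open_ellinf :: "ellinf set \<Rightarrow> bool" where
  "open_ellinf U = (\<forall>x\<in>U. eventually (\<lambda>(x', y). x' = x \<longrightarrow> y \<in> U) uniformity)"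

lemma abs_ellinf_le_norm: "\<bar>ellinf_nth x k\<bar> \<le> norm x"
proof (cases "k = 0")
  case True
  have "\<bar>ellinf_nth x 1\<bar> \<le> norm x"
    unfolding norm_ellinf_def by (rule cSUP_upper[OF _ bdd_above_ellinf]) simp
  with True show ?thesis by simp
next
  case False
  then show ?thesis
    unfolding norm_ellinf_def by (intro cSUP_upper[OF _ bdd_above_ellinf]) simp
qed

lemma norm_ellinf_le: "(\<And>k. k \<ge> 1 \<Longrightarrow> \<bar>ellinf_nth x k\<bar> \<le> B) \<Longrightarrow> norm x \<le> B"
  unfolding norm_ellinf_def by (rule cSUP_least) auto

instance
proof
  fix x y :: ellinf and a :: real
  have le: "norm (a *\<^sub>R x) \<le> \<bar>a\<bar> * norm x" for a and x :: ellinf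
    by (rule norm_ellinf_le)
      (simp add: scaleR_ellinf.rep_eq abs_mult mult_left_mono abs_ellinf_le_norm)
  show "(norm x = 0) = (x = 0)"
  proof
    assume "norm x = 0"
    then show "x = 0"
      using abs_ellinf_le_norm[of x] by (intro ellinf_eqI) (simp add: zero_ellinf.rep_eq)
  next
    assume "x = 0"
    then show "norm x = 0"
      by (simp add: norm_ellinf_def zero_ellinf.rep_eq)
  qed
  show "norm (x + y) \<le> norm x + norm y"
  proof (rule norm_ellinf_le)
    fix k
    show "\<bar>ellinf_nth (x + y) k\<bar> \<le> norm x + norm y"
      using abs_ellinf_le_norm[of x k] abs_ellinf_le_norm[of y k]
      by (simp add: plus_ellinf.rep_eq)
  qed
  show "norm (a *\<^sub>R x) = \<bar>a\<bar> * norm x"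
  proof (cases "a = 0")
    case True
    then show ?thesis using le[of 0 x] abs_ellinf_le_norm[of "0 *\<^sub>R x" 0] by simp
  next
    case False
    then have "norm x \<le> norm (a *\<^sub>R x) / \<bar>a\<bar>"
      using le[of "inverse a" "a *\<^sub>R x"] by (simp add: field_simps)
    with False show ?thesis using le[of a x] by (simp add: field_simps)
  qed
qed (simp_all add: sgn_ellinf_def dist_ellinf_def uniformity_ellinf_def open_ellinf_def)

end

definition pairing :: "ellinf \<Rightarrow> ell1 \<Rightarrow> real" where
  "pairing \<xi> x = (\<Sum>k. ellinf_nth \<xi> k * ell1_nth x k)"

text \<open>
  The Banach space adjoint, with the dual of \<^typ>\<open>ell1\<close> identified with \<^typ>\<open>ellinf\<close> through
  \<^const>\<open>pairing\<close>; existence and uniqueness are shown in \<open>pairing_adj\<close> and \<open>pairing_unique\<close>.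
\<close>

definition adj :: "(ell1 \<Rightarrow>\<^sub>L 'y::real_normed_vector) \<Rightarrow> ('y \<Rightarrow>\<^sub>L real) \<Rightarrow> ellinf" where
  "adj A \<eta> = (THE \<xi>. \<forall>x. pairing \<xi> x = \<eta> (A x))"

lift_definition unit_seq :: "nat \<Rightarrow> ell1" is "\<lambda>k j. if j = k \<and> k \<ge> 1 then 1 else 0"
  subgoal for k by (auto intro!: summable_finite[of "{k}"])
  done

lemma norm_unit_seq_le: "norm (unit_seq k) \<le> 1"
proof -
  have "norm (unit_seq k) = (\<Sum>j\<in>{k}. \<bar>ell1_nth (unit_seq k) j\<bar>)"
    unfolding norm_ell1_def by (rule suminf_finite) (auto simp: unit_seq.rep_eq)
  then show ?thesis by (simp add: unit_seq.rep_eq)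
qed

lemma pairing_unit_seq: "k \<ge> 1 \<Longrightarrow> pairing \<xi> (unit_seq k) = ellinf_nth \<xi> k"
proof -
  assume k: "k \<ge> 1"
  have "pairing \<xi> (unit_seq k) = (\<Sum>j\<in>{k}. ellinf_nth \<xi> j * ell1_nth (unit_seq k) j)"
    unfolding pairing_def by (rule suminf_finite) (auto simp: unit_seq.rep_eq)
  with k show ?thesis by (simp add: unit_seq.rep_eq)
qed

lemma pairing_unique: "(\<And>x. pairing \<xi> x = pairing \<zeta> x) \<Longrightarrow> \<xi> = \<zeta>"
  by (metis ellinf_eqI pairing_unit_seq)

lemma unit_seq_expansion: "(\<lambda>k. ell1_nth x k *\<^sub>R unit_seq k) sums x"
proof -
  let ?S = "\<lambda>n. \<Sum>k<n. ell1_nth x k *\<^sub>R unit_seq k"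
  have nth: "ell1_nth (?S n) j = (if j < n then ell1_nth x j else 0)" for n j
  proof (cases "j = 0")
    case True
    then show ?thesis by simp
  next
    case False
    then show ?thesis
      by (induction n) (auto simp: zero_ell1.rep_eq plus_ell1.rep_eq scaleR_ell1.rep_eq
          unit_seq.rep_eq less_Suc_eq)
  qed
  have "norm (?S n - x) = (\<Sum>k. \<bar>ell1_nth x (k + n)\<bar>)" for n
  proof -
    have "norm (?S n - x) = (\<Sum>k. \<bar>ell1_nth (?S n - x) (k + n)\<bar>)
        + (\<Sum>k<n. \<bar>ell1_nth (?S n - x) k\<bar>)"
      unfolding norm_ell1_def by (rule suminf_split_initial_segment[OF summable_ell1])
    then show ?thesis by (simp add: minus_ell1.rep_eq nth)
  qed
  moreover have "(\<lambda>n. \<Sum>k. \<bar>ell1_nth x (k + n)\<bar>) \<longlonglongrightarrow> 0"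
    using suminf_exist_split2[OF summable_ell1] by simp
  ultimately have "(\<lambda>n. norm (?S n - x)) \<longlonglongrightarrow> 0" by simp
  then show ?thesis
    unfolding sums_def by (simp only: tendsto_norm_zero_iff LIM_zero_iff)
qed

lemma ex_pairing:
  fixes \<phi> :: "ell1 \<Rightarrow>\<^sub>L real"
  shows "\<exists>\<xi>. \<forall>x. pairing \<xi> x = \<phi> x"
proof -
  let ?z = "\<lambda>k. if k \<ge> 1 then \<phi> (unit_seq k) else 0"
  have "norm (?z k) \<le> norm \<phi>" for k
    using norm_blinfun[of \<phi> "unit_seq k"] mult_left_le[OF norm_unit_seq_le[of k] norm_ge_zero[of \<phi>]]
    by simp
  then have "bounded (range ?z)" by (intro boundedI[where B = "norm \<phi>"]) (elim imageE, simp only:)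
  then have z: "ellinf_nth (Abs_ellinf ?z) = ?z"
    by (simp add: Abs_ellinf_inverse)
  have "pairing (Abs_ellinf ?z) x = \<phi> x" for x
  proof -
    have "(\<lambda>k. \<phi> (ell1_nth x k *\<^sub>R unit_seq k)) sums \<phi> x"
      by (rule bounded_linear.sums[OF blinfun.bounded_linear_right unit_seq_expansion])
    moreover have "\<phi> (ell1_nth x k *\<^sub>R unit_seq k) = ?z k * ell1_nth x k" for k
      by (cases "k = 0") (auto simp: blinfun.scaleR_right)
    ultimately show ?thesis
      unfolding pairing_def z by (simp add: sums_iff)
  qed
  then show ?thesis by blast
qed

lemma pairing_adj: "pairing (adj A \<eta>) x = \<eta> (A x)"
proof -
  obtain \<xi> where \<xi>: "\<forall>x. pairing \<xi> x = \<eta> (A x)"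
    using ex_pairing[of "\<eta> o\<^sub>L A"] by auto
  then have "\<exists>!\<xi>. \<forall>x. pairing \<xi> x = \<eta> (A x)"
    by (metis pairing_unique)
  from theI'[OF this] show ?thesis unfolding adj_def by blast
qed

lemma adj_nth: "k \<ge> 1 \<Longrightarrow> ellinf_nth (adj A \<eta>) k = \<eta> (A (unit_seq k))"
  by (metis pairing_adj pairing_unit_seq)

definition supp :: "ellinf \<Rightarrow> nat set" where
  "supp \<xi> = {k. k \<ge> 1 \<and> ellinf_nth \<xi> k \<noteq> 0}"

lift_definition proj :: "nat set \<Rightarrow> ellinf \<Rightarrow> ellinf" is
  "\<lambda>M x k. if k \<in> M then x k else 0"
  by (force intro: bounded_subset[of "insert 0 (range _)"])

definition sign_seqs :: "nat set \<Rightarrow> ellinf set" where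
  "sign_seqs M = {\<xi>. supp \<xi> \<subseteq> M \<and> (\<forall>k\<ge>1. ellinf_nth \<xi> k \<in> {-1, 0, 1})}"

definition source_assumption ::
  "(ell1 \<Rightarrow>\<^sub>L 'y::real_normed_vector) \<Rightarrow> (nat \<Rightarrow> nat set set) \<Rightarrow> (nat \<Rightarrow> real) \<Rightarrow> real \<Rightarrow> bool" where
  "source_assumption A \<M> \<gamma> c \<longleftrightarrow>
     (\<forall>n\<ge>1. \<gamma> n > 0) \<and> 0 \<le> c \<and> c < 1 \<and>
     (\<forall>n\<ge>1. (\<forall>M\<in>\<M> n. M \<subseteq> {1..} \<and> finite M \<and> card M = n) \<and> {1..n} \<in> \<M> n) \<and>
     (\<forall>n\<ge>1. \<forall>\<xi>\<in>(\<Union>M\<in>\<M> n. sign_seqs M). \<exists>\<eta> :: 'y \<Rightarrow>\<^sub>L real.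
        norm \<eta> \<le> \<gamma> n \<and>
        proj (supp \<xi>) (adj A \<eta>) = \<xi> \<and>
        norm (adj A \<eta> - proj (supp \<xi>) (adj A \<eta>)) \<le> c)"

end

theory Submission
  imports Defs
begin

text \<open>On the first n coordinates the sequences \<open>adj A (f n k)\<close> are the unit
  vectors, so any prescribed values there can be interpolated linearly. For a sign sequence \<xi>
  supported in {1..n}, the source element is the sum of \<xi>_k f(n,k) over k = 1..n. By linearity
  of the adjoint (\<open>adj_sum_scaleR_nth\<close>) its image equals \<xi> on {1..n}, zeros
  included, so the residual off the support of \<xi> lives only on indices beyond n. There, since
  all |\<xi>_k| \<le> 1, the triangle inequality (\<open>norm_sum_scaleR_le\<close>) and the
  column-sum hypothesis bound it by c. The same inequality in the dual of Y gives the norm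
  bound.\<close>

lemma adj_sum_scaleR_nth:
  assumes "l \<ge> 1"
  shows "ellinf_nth (adj A (\<Sum>k\<in>K. a k *\<^sub>R g k)) l = (\<Sum>k\<in>K. a k * ellinf_nth (adj A (g k)) l)"
  using assms by (simp add: adj_nth blinfun.sum_left blinfun.scaleR_left)

text \<open>Stated for a general normed space because it serves twice: in the dual of Y to bound the
  source element, and in the reals to bound single components of its image.\<close>

lemma norm_sum_scaleR_le:
  fixes g :: "'i \<Rightarrow> 'a::real_normed_vector"
  assumes "\<And>k. k \<in> K \<Longrightarrow> \<bar>a k\<bar> \<le> 1"
  shows "norm (\<Sum>k\<in>K. a k *\<^sub>R g k) \<le> (\<Sum>k\<in>K. norm (g k))"
  by (rule sum_norm_le) (simp add: assms mult_left_le_one_le)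

theorem proposition4p1:
  fixes A :: "ell1 \<Rightarrow>\<^sub>L 'y::banach"
    and f :: "nat \<Rightarrow> nat \<Rightarrow> ('y \<Rightarrow>\<^sub>L real)"
    and c :: real
  assumes "inj (blinfun_apply A)"
    and "0 \<le> c" and "c < 1"
    and "\<And>n k. n \<ge> 1 \<Longrightarrow> k \<in> {1..n} \<Longrightarrow>
      (\<forall>l\<in>{1..n} - {k}. ellinf_nth (adj A (f n k)) l = 0) \<and> ellinf_nth (adj A (f n k)) k = 1"
    and "\<And>n l. n \<ge> 1 \<Longrightarrow> l > n \<Longrightarrow> (\<Sum>k=1..n. \<bar>ellinf_nth (adj A (f n k)) l\<bar>) \<le> c"
  shows "source_assumption A (\<lambda>n. {{1..n}}) (\<lambda>n. \<Sum>k=1..n. norm (f n k)) c"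
proof -
  have pos: "(\<Sum>k=1..n. norm (f n k)) > 0" if n: "n \<ge> 1" for n
  proof -
    \<comment> \<open>The adjoint image of \<open>f n 1\<close> has first component 1, so this
      functional cannot vanish, and one positive term makes the sum of norms positive.\<close>
    have "f n 1 \<noteq> 0"
      using assms(4)[of n 1] n by (auto simp: adj_nth)
    with n show ?thesis
      by (intro sum_pos2[of _ 1]) auto
  qed
  have source: "\<exists>\<eta> :: 'y \<Rightarrow>\<^sub>L real. norm \<eta> \<le> (\<Sum>k=1..n. norm (f n k)) \<and>
      proj (supp \<xi>) (adj A \<eta>) = \<xi> \<and> norm (adj A \<eta> - proj (supp \<xi>) (adj A \<eta>)) \<le> c"
    if n: "n \<ge> 1" and \<xi>: "\<xi> \<in> sign_seqs {1..n}" for n \<xi>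
  proof -
    have supp: "supp \<xi> \<subseteq> {1..n}"
      using \<xi> by (simp add: sign_seqs_def)
    have le1: "\<bar>ellinf_nth \<xi> k\<bar> \<le> 1" if "k \<ge> 1" for k
      using \<xi> that by (fastforce simp: sign_seqs_def)
    define \<eta> where "\<eta> = (\<Sum>k=1..n. ellinf_nth \<xi> k *\<^sub>R f n k)"
    have inside: "ellinf_nth (adj A \<eta>) l = ellinf_nth \<xi> l" if l: "l \<in> {1..n}" for l
    proof -
      have "ellinf_nth (adj A \<eta>) l = (\<Sum>k=1..n. ellinf_nth \<xi> k * ellinf_nth (adj A (f n k)) l)"
        using l by (simp add: \<eta>_def adj_sum_scaleR_nth)
      also have "\<dots> = (\<Sum>k=1..n. if k = l then ellinf_nth \<xi> k else 0)"
        using assms(4)[OF n] l by (intro sum.cong) auto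
      finally show ?thesis
        using l by simp
    qed
    have outside: "\<bar>ellinf_nth (adj A \<eta>) l\<bar> \<le> c" if l: "l > n" for l
    proof -
      \<comment> \<open>Real multiplication is written as scaling, so that
        \<open>norm_sum_scaleR_le\<close> applies with the reals as the normed space.\<close>
      have "\<bar>ellinf_nth (adj A \<eta>) l\<bar>
          = norm (\<Sum>k=1..n. ellinf_nth \<xi> k *\<^sub>R ellinf_nth (adj A (f n k)) l)"
        using l by (simp add: \<eta>_def adj_sum_scaleR_nth)
      also have "\<dots> \<le> (\<Sum>k=1..n. norm (ellinf_nth (adj A (f n k)) l))"
        by (rule norm_sum_scaleR_le) (simp add: le1)
      also have "\<dots> \<le> c"
        using assms(5)[OF n l] by simp
      finally show ?thesis .
    qed
    have "norm \<eta> \<le> (\<Sum>k=1..n. norm (f n k))"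
      unfolding \<eta>_def by (rule norm_sum_scaleR_le) (simp add: le1)
    moreover have proj: "proj (supp \<xi>) (adj A \<eta>) = \<xi>"
    proof (rule ellinf_eqI)
      fix k :: nat assume "k \<ge> 1"
      then show "ellinf_nth (proj (supp \<xi>) (adj A \<eta>)) k = ellinf_nth \<xi> k"
        using supp inside by (auto simp: proj.rep_eq supp_def)
    qed
    \<comment> \<open>By \<open>proj\<close> this is the residual. It is zero up to n, even at
      indices outside the support of \<xi>; beyond n it coincides with \<open>adj A \<eta>\<close>,
      because \<xi> vanishes there.\<close>
    moreover have "norm (adj A \<eta> - \<xi>) \<le> c"
    proof (rule norm_ellinf_le)
      fix k :: nat assume k: "k \<ge> 1"
      show "\<bar>ellinf_nth (adj A \<eta> - \<xi>) k\<bar> \<le> c"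
      proof (cases "k \<le> n")
        case True
        with k inside \<open>0 \<le> c\<close> show ?thesis
          by (simp add: minus_ellinf.rep_eq)
      next
        case False
        with supp have "k \<notin> supp \<xi>"
          by auto
        with k have "ellinf_nth \<xi> k = 0"
          by (simp add: supp_def)
        with False outside show ?thesis
          by (simp add: minus_ellinf.rep_eq)
      qed
    qed
    ultimately show ?thesis
      by auto
  qed
  show ?thesis
    unfolding source_assumption_def using \<open>0 \<le> c\<close> \<open>c < 1\<close> pos source by auto
qed

end
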